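(* Let $\mu\in\mathbb{R}$ and $\sigma>0$, and let $X\sim \mathrm{LN}(\mu,\sigma^2)$ with Laplace transform $\phi(z;\mu,\sigma)=\mathbb{E}[e^{-zX}]$, $\operatorname{Re}(z)\ge 0$. Then $\phi(\cdot;\mu,\sigma)$ is analytically continued to $\mathbb{C}\setminus(-\infty,0]$ by the equation $$\phi(z;\mu,\sigma)=\Phi(1,\mu+\ln z;\sigma).$$ That is, the function $z\mapsto \Phi(1,\mu+\ln z;\sigma)$ is analytic on $\mathbb{C}\setminus(-\infty,0]$ and coincides with $\mathbb{E}[e^{-zX}]$ for all $z\neq 0$ with $\operatorname{Re}(z)\ge 0$.
   Context: $X\sim\mathrm{LN}(\mu,\sigma^2)$ (lognormal, $\mu\in\mathbb{R}$, $\sigma>0$) means that $X$ is a positive random variable with density $f(x;\mu,\sigma)=\frac{1}{\sqrt{2\pi}\,\sigma x}\exp\left[-\frac{(\ln x-\mu)^2}{2\sigma^2}\right]$, $x>0$. For $z\in\mathbb{C}$ with $\operatorname{Re}(z)\ge 0$ and $w\in\mathbb{C}$, define $$\Phi(z,w;\sigma):=C(w,\sigma)\int_0^\infty \frac1x\exp\left[-zx-\frac{1}{2\sigma^2}(\ln x)^2+\frac{w}{\sigma^2}\ln x\right]dx,\qquad C(w,\sigma):=(2\pi\sigma^2)^{-1/2}\exp\left(-\frac{w^2}{2\sigma^2}\right).$$ $\ln$ denotes the principal branch of the complex logarithm. *)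

theory Defs
  imports "HOL-Probability.Probability" "HOL-Complex_Analysis.Complex_Analysis"
begin

definition lognormal_density :: "real \<Rightarrow> real \<Rightarrow> real \<Rightarrow> real" where
  "lognormal_density \<mu> \<sigma> x =
     (if x > 0 then 1 / (sqrt (2 * pi) * \<sigma> * x) * exp (- ((ln x - \<mu>)\<^sup>2 / (2 * \<sigma>\<^sup>2))) else 0)"

text \<open>Since the density vanishes on the nonpositive reals, a variable with this law is
  positive almost surely; positivity at every sample point is not required.\<close>

definition lognormal_distributed :: "'a measure \<Rightarrow> ('a \<Rightarrow> real) \<Rightarrow> real \<Rightarrow> real \<Rightarrow> bool" where
  "lognormal_distributed M X \<mu> \<sigma> \<longleftrightarrow> distributed M lborel X (\<lambda>x. ennreal (lognormal_density \<mu> \<sigma> x))"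

definition laplace_transform :: "'a measure \<Rightarrow> ('a \<Rightarrow> real) \<Rightarrow> complex \<Rightarrow> complex" where
  "laplace_transform M X z = (LINT \<omega>|M. exp (- z * complex_of_real (X \<omega>)))"

definition C_coeff :: "complex \<Rightarrow> real \<Rightarrow> complex" where
  "C_coeff w \<sigma> =
     complex_of_real ((2 * pi * \<sigma>\<^sup>2) powr (- 1 / 2)) * exp (- (w\<^sup>2 / (2 * complex_of_real \<sigma> ^ 2)))"

text \<open>The integral converges absolutely when \<open>\<sigma> > 0\<close> and \<open>Re z \<ge> 0\<close>; other arguments are
  not meaningful.\<close>

definition Phi :: "complex \<Rightarrow> complex \<Rightarrow> real \<Rightarrow> complex" where
  "Phi z w \<sigma> =
     C_coeff w \<sigma> *
     (LINT x:{0<..}|lborel.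
        complex_of_real (1 / x) *
        exp (- z * complex_of_real x
             - complex_of_real (1 / (2 * \<sigma>\<^sup>2) * (ln x)\<^sup>2)
             + w / complex_of_real (\<sigma>\<^sup>2) * complex_of_real (ln x)))"

end

theory Submission
  imports Defs
begin

text \<open>For real \<open>m\<close>, \<open>Phi z m \<sigma>\<close> is the Laplace transform of the lognormal density with
  parameter \<open>m\<close>, and scaling the variable by \<open>c > 0\<close> shifts \<open>m\<close> by \<open>ln c\<close>. Hence the two sides
  agree for \<open>z > 0\<close>. Both are holomorphic on the open right half-plane, as dominated integrals of
  holomorphic functions (\<open>Phi 1 w \<sigma>\<close> is even entire in \<open>w\<close>), so they agree there by the identity
  theorem, and on the punctured imaginary axis by continuity.\<close>

section \<open>Holomorphic dependence of a dominated integral on a parameter\<close>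

lemma holomorphic_on_integral:
  fixes f :: "complex \<Rightarrow> 'a \<Rightarrow> complex"
  assumes S: "open S"
    and hol: "\<And>x. x \<in> space M \<Longrightarrow> (\<lambda>z. f z x) holomorphic_on S"
    and meas: "\<And>z. z \<in> S \<Longrightarrow> f z \<in> borel_measurable M"
    and g: "integrable M g"
    and bound: "\<And>z x. z \<in> S \<Longrightarrow> x \<in> space M \<Longrightarrow> norm (f z x) \<le> g x"
  shows "(\<lambda>z. \<integral>x. f z x \<partial>M) holomorphic_on S"
proof -
  have int: "integrable M (f z)" if "z \<in> S" for z
    using g by (rule Bochner_Integration.integrable_bound) (use that bound meas in \<open>force intro!: AE_I2\<close>)+
  have "\<exists>D. ((\<lambda>z. \<integral>x. f z x \<partial>M) has_field_derivative D) (at z)" if z: "z \<in> S" for z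
  proof -
    obtain e where e: "e > 0" "cball z e \<subseteq> S"
      using S z open_contains_cball by blast
    \<comment> \<open>Half the radius leaves room for nested discs: for every \<open>v\<close> in
      \<open>cball z r\<close>, the disc of radius \<open>r\<close> around \<open>v\<close> on which
      Cauchy's estimate is applied still lies in \<open>S\<close>.\<close>
    define r where "r = e / 2"
    have r: "r > 0" using e by (simp add: r_def)
    have sub: "cball v r \<subseteq> S" if "v \<in> cball z r" for v
    proof
      fix y assume "y \<in> cball v r"
      then have "dist z y \<le> e"
        using that dist_triangle[of z y v] by (simp add: r_def)
      then show "y \<in> S" using e(2) by auto
    qed
    define D where "D x = deriv (\<lambda>z. f z x) z" for x
    have ball_S: "v \<in> S" if "v \<in> ball z r" for v
      using sub[of z] r that by auto
    \<comment> \<open>Cauchy's estimate on discs of radius \<open>r\<close> makes \<open>g / r\<close> dominate the difference quotients.\<close>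
    have lip: "norm ((f u x - f z x) / (u - z)) \<le> g x / r"
      if u: "u \<in> ball z r" "u \<noteq> z" and x: "x \<in> space M" for u x
    proof -
      have "norm (f u x - f z x) \<le> (g x / r) * norm (u - z)"
      proof (rule field_differentiable_bound[of "cball z r" "\<lambda>z. f z x" "\<lambda>z. deriv (\<lambda>z. f z x) z"])
        fix v assume v: "v \<in> cball z r"
        then have vS: "v \<in> S" using sub[OF v] r by auto
        show "((\<lambda>z. f z x) has_field_derivative deriv (\<lambda>z. f z x) v) (at v within cball z r)"
          using hol[OF x] S vS holomorphic_derivI by blast
        have "cmod ((deriv ^^ 1) (\<lambda>z. f z x) v) \<le> fact 1 * g x / r ^ 1"
        proof (rule Cauchy_inequality)
          show "(\<lambda>z. f z x) holomorphic_on ball v r"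
            using hol[OF x] sub[OF v] by (meson ball_subset_cball holomorphic_on_subset)
          show "continuous_on (cball v r) (\<lambda>z. f z x)"
            using hol[OF x] sub[OF v] by (meson holomorphic_on_imp_continuous_on continuous_on_subset)
          show "cmod (f \<zeta> x) \<le> g x" if "cmod (v - \<zeta>) = r" for \<zeta>
            using that sub[OF v] by (intro bound x) (auto simp: dist_norm)
        qed (use r in auto)
        then show "cmod (deriv (\<lambda>z. f z x) v) \<le> g x / r" by simp
      qed (use u r in auto)
      then show ?thesis using u by (simp add: norm_divide divide_le_eq)
    qed
    have lim: "((\<lambda>u. (f u x - f z x) / (u - z)) \<longlongrightarrow> D x) (at z within ball z r)" if "x \<in> space M" for x
    proof -
      have "((\<lambda>z. f z x) has_field_derivative D x) (at z)"
        unfolding D_def using hol[OF that] S z holomorphic_derivI by blast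
      then show ?thesis
        by (simp add: has_field_derivative_iff tendsto_within_subset[OF _ subset_UNIV])
    qed
    have "((\<lambda>u. ((\<integral>x. f u x \<partial>M) - (\<integral>x. f z x \<partial>M)) / (u - z)) \<longlongrightarrow> (\<integral>x. D x \<partial>M)) (at z within ball z r)"
      \<comment> \<open>Dominated convergence speaks of sequences, so the limit of the difference
        quotients is tested along an arbitrary sequence in the punctured disc.\<close>
      unfolding tendsto_at_iff_sequentially comp_def
    proof safe
      fix u :: "nat \<Rightarrow> complex"
      assume u: "\<forall>i. u i \<in> ball z r - {z}" and ulim: "u \<longlonglongrightarrow> z"
      have uS: "u n \<in> S" for n using u ball_S by blast
      have ptw: "(\<lambda>n. (f (u n) x - f z x) / (u n - z)) \<longlonglongrightarrow> D x" if "x \<in> space M" for x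
        using lim[OF that] u ulim unfolding tendsto_at_iff_sequentially comp_def by blast
      have mq: "(\<lambda>x. (f (u n) x - f z x) / (u n - z)) \<in> borel_measurable M" for n
        using meas[OF uS] meas[OF z] by simp
      have "(\<lambda>n. \<integral>x. (f (u n) x - f z x) / (u n - z) \<partial>M) \<longlonglongrightarrow> (\<integral>x. D x \<partial>M)"
      proof (rule integral_dominated_convergence[where w = "\<lambda>x. g x / r"])
        show "D \<in> borel_measurable M"
          by (rule borel_measurable_LIMSEQ_metric[OF mq ptw])
        show "AE x in M. norm ((f (u n) x - f z x) / (u n - z)) \<le> g x / r" for n
          using u lip by (intro AE_I2) blast
      qed (use g mq ptw in auto)
      moreover have "(\<integral>x. (f (u n) x - f z x) / (u n - z) \<partial>M)
          = ((\<integral>x. f (u n) x \<partial>M) - (\<integral>x. f z x \<partial>M)) / (u n - z)" for n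
        using int[OF uS] int[OF z] by simp
      ultimately show "(\<lambda>n. ((\<integral>x. f (u n) x \<partial>M) - (\<integral>x. f z x \<partial>M)) / (u n - z)) \<longlonglongrightarrow> (\<integral>x. D x \<partial>M)"
        by (simp only:)
    qed
    moreover have "at z within ball z r = at z"
      using r by (intro at_within_open) auto
    ultimately show ?thesis
      by (auto simp: has_field_derivative_iff)
  qed
  then show ?thesis
    using S by (auto simp: holomorphic_on_open)
qed

section \<open>The lognormal density\<close>

lemma lognormal_density_nonneg: "\<sigma> > 0 \<Longrightarrow> 0 \<le> lognormal_density m \<sigma> x"
  by (simp add: lognormal_density_def)

lemma lognormal_density_measurable [measurable]: "lognormal_density m \<sigma> \<in> borel_measurable borel"
  unfolding lognormal_density_def[abs_def] by measurable

text \<open>This is the density form of the fact that multiplying a lognormal variable by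
  \<open>c\<close> adds \<open>ln c\<close> to its location parameter.\<close>

lemma lognormal_density_scale:
  assumes "c > 0"
  shows "lognormal_density (m + ln c) \<sigma> (c * x) = lognormal_density m \<sigma> x / c"
  using assms by (auto simp: lognormal_density_def ln_mult zero_less_mult_iff)

text \<open>Expanding the square splits off a factor independent of \<open>x\<close>, which is
  \<open>C_coeff\<close> at \<open>m\<close>, from the kernel that \<open>Phi\<close>
  integrates.\<close>

lemma lognormal_density_expand:
  assumes "\<sigma> > 0" "x > 0"
  shows "lognormal_density m \<sigma> x = (2 * pi * \<sigma>\<^sup>2) powr (- 1 / 2) * exp (- (m\<^sup>2 / (2 * \<sigma>\<^sup>2))) *
    (1 / x * exp (- (1 / (2 * \<sigma>\<^sup>2) * (ln x)\<^sup>2) + m / \<sigma>\<^sup>2 * ln x))"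
proof -
  have "- ((ln x - m)\<^sup>2 / (2 * \<sigma>\<^sup>2)) = - (m\<^sup>2 / (2 * \<sigma>\<^sup>2)) + (- (1 / (2 * \<sigma>\<^sup>2) * (ln x)\<^sup>2) + m / \<sigma>\<^sup>2 * ln x)"
    using assms by (simp add: field_simps power2_eq_square)
  moreover have "(2 * pi * \<sigma>\<^sup>2) powr (- 1 / 2) = 1 / (sqrt (2 * pi) * \<sigma>)"
    using assms powr_minus_divide[of "2 * pi * \<sigma>\<^sup>2" "1 / 2"]
    by (simp add: powr_half_sqrt real_sqrt_mult)
  ultimately show ?thesis
    unfolding lognormal_density_def using assms by (simp only: exp_add if_True) simp
qed

text \<open>The substitution of \<open>c * x\<close> for \<open>x\<close> with
  \<open>c = exp (m' - m)\<close> turns one density into a multiple of the other, so integrability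
  for one location parameter yields it for all, without computing a Gaussian integral.\<close>

lemma integrable_lognormal_density_shift:
  assumes "integrable lborel (lognormal_density m \<sigma>)"
  shows "integrable lborel (lognormal_density m' \<sigma>)"
proof -
  define c where "c = exp (m' - m)"
  have c: "c > 0" "m' = m + ln c" by (auto simp: c_def)
  have "integrable lborel (\<lambda>x. lognormal_density m' \<sigma> (0 + c * x))"
    using assms by (simp add: c(2) lognormal_density_scale[OF c(1)])
  then show ?thesis
    using c(1) by (subst (asm) lborel_integrable_real_affine_iff) auto
qed

section \<open>\<open>Phi\<close> at a real second argument\<close>

lemma Phi_of_real:
  assumes "\<sigma> > 0"
  shows "Phi z (complex_of_real m) \<sigma> =
    (LINT x|lborel. lognormal_density m \<sigma> x *\<^sub>R exp (- z * complex_of_real x))"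
proof -
  have "C_coeff (complex_of_real m) \<sigma> * (indicator {0<..} x *\<^sub>R (complex_of_real (1 / x) *
        exp (- z * complex_of_real x - complex_of_real (1 / (2 * \<sigma>\<^sup>2) * (ln x)\<^sup>2)
             + complex_of_real m / complex_of_real (\<sigma>\<^sup>2) * complex_of_real (ln x))))
     = lognormal_density m \<sigma> x *\<^sub>R exp (- z * complex_of_real x)" for x
  proof (cases "x > 0")
    case True
    have "exp (- z * complex_of_real x - complex_of_real (1 / (2 * \<sigma>\<^sup>2) * (ln x)\<^sup>2)
             + complex_of_real m / complex_of_real (\<sigma>\<^sup>2) * complex_of_real (ln x))
       = complex_of_real (exp (- (1 / (2 * \<sigma>\<^sup>2) * (ln x)\<^sup>2) + m / \<sigma>\<^sup>2 * ln x)) * exp (- z * complex_of_real x)"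
      unfolding exp_of_real[symmetric] exp_add[symmetric] by (rule arg_cong[where f = exp]) simp
    moreover have "C_coeff (complex_of_real m) \<sigma> =
        complex_of_real ((2 * pi * \<sigma>\<^sup>2) powr (- 1 / 2) * exp (- (m\<^sup>2 / (2 * \<sigma>\<^sup>2))))"
      by (simp add: C_coeff_def exp_of_real[symmetric])
    ultimately show ?thesis
      using True by (simp add: lognormal_density_expand[OF assms True] scaleR_conv_of_real mult_ac)
  next
    case False
    then show ?thesis by (simp add: lognormal_density_def)
  qed
  \<comment> \<open>The integrands agree pointwise. The constant moves inside by a rule that also
    covers divergent integrals, whose value is 0 by convention.\<close>
  then show ?thesis
    unfolding Phi_def set_lebesgue_integral_def
    by (subst integral_mult_right_zero[symmetric]) simp
qed

text \<open>Substituting \<open>c * x\<close> for \<open>x\<close>, the Jacobian \<open>c\<close>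
  cancels the factor \<open>1 / c\<close> from \<open>lognormal_density_scale\<close>. With
  \<open>z = 1\<close> this is the continuation formula on the positive real axis.\<close>

lemma Phi_of_real_scale:
  assumes "\<sigma> > 0" "c > 0"
  shows "Phi z (complex_of_real (m + ln c)) \<sigma> = Phi (z * complex_of_real c) (complex_of_real m) \<sigma>"
proof -
  have "Phi z (complex_of_real (m + ln c)) \<sigma> = \<bar>c\<bar> *\<^sub>R (LINT x|lborel.
      lognormal_density (m + ln c) \<sigma> (0 + c * x) *\<^sub>R exp (- z * complex_of_real (0 + c * x)))"
    unfolding Phi_of_real[OF assms(1)] by (rule lborel_integral_real_affine) (use assms in auto)
  also have "\<dots> = (LINT x|lborel. \<bar>c\<bar> *\<^sub>R
      (lognormal_density (m + ln c) \<sigma> (0 + c * x) *\<^sub>R exp (- z * complex_of_real (0 + c * x))))"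
    by (rule integral_scaleR_right[symmetric])
  also have "\<dots> = Phi (z * complex_of_real c) (complex_of_real m) \<sigma>"
    using assms by (simp add: Phi_of_real lognormal_density_scale mult.assoc)
  finally show ?thesis .
qed


section \<open>\<open>Phi 1 w \<sigma>\<close> is entire in \<open>w\<close>\<close>

lemma Phi_1_holomorphic:
  assumes \<sigma>: "\<sigma> > 0" and int: "integrable lborel (lognormal_density m \<sigma>)"
  shows "(\<lambda>w. Phi 1 w \<sigma>) holomorphic_on A"
proof -
  define f where "f w x = indicator {0<..} x *\<^sub>R (complex_of_real (1 / x) *
        exp (- 1 * complex_of_real x - complex_of_real (1 / (2 * \<sigma>\<^sup>2) * (ln x)\<^sup>2)
             + w / complex_of_real (\<sigma>\<^sup>2) * complex_of_real (ln x)))" for w x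
  have Phi: "Phi 1 w \<sigma> = C_coeff w \<sigma> * (\<integral>x. f w x \<partial>lborel)" for w
    by (simp only: Phi_def set_lebesgue_integral_def f_def)
  have hol_int: "(\<lambda>w. \<integral>x. f w x \<partial>lborel) holomorphic_on ball 0 R" for R
  proof -
    \<comment> \<open>This is \<open>C_coeff\<close> at both \<open>R\<close> and
      \<open>- R\<close>, since only the square enters. Dividing the two densities by it leaves the
      bare kernels, whose sum dominates the integrand for all \<open>w\<close> in the disc.\<close>
    define c where "c = (2 * pi * \<sigma>\<^sup>2) powr (- 1 / 2) * exp (- (R\<^sup>2 / (2 * \<sigma>\<^sup>2)))"
    have c: "c > 0" using \<sigma> by (simp add: c_def)
    show ?thesis
    proof (rule holomorphic_on_integral[where
          g = "\<lambda>x. (lognormal_density R \<sigma> x + lognormal_density (- R) \<sigma> x) / c"])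
      show "integrable lborel (\<lambda>x. (lognormal_density R \<sigma> x + lognormal_density (- R) \<sigma> x) / c)"
        by (intro integrable_divide_zero Bochner_Integration.integrable_add
              integrable_lognormal_density_shift[OF int])
      show "f w \<in> borel_measurable lborel" for w
        unfolding f_def[abs_def] by measurable
      show "(\<lambda>w. f w x) holomorphic_on ball 0 R" for x
        unfolding f_def scaleR_conv_of_real by (intro holomorphic_intros) (use \<sigma> in auto)
      show "norm (f w x) \<le> (lognormal_density R \<sigma> x + lognormal_density (- R) \<sigma> x) / c"
        if w: "w \<in> ball 0 R" for w x
      proof (cases "x > 0")
        case True
        have k: "lognormal_density R \<sigma> x / c = 1 / x * exp (- (1 / (2 * \<sigma>\<^sup>2) * (ln x)\<^sup>2) + R / \<sigma>\<^sup>2 * ln x)"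
          "lognormal_density (- R) \<sigma> x / c = 1 / x * exp (- (1 / (2 * \<sigma>\<^sup>2) * (ln x)\<^sup>2) + (- R) / \<sigma>\<^sup>2 * ln x)"
          using c \<sigma> by (simp_all add: lognormal_density_expand[OF \<sigma> True] c_def)
        have "Re w * ln x \<le> \<bar>Re w * ln x\<bar>" by simp
        also have "\<dots> \<le> R * \<bar>ln x\<bar>"
          unfolding abs_mult using w abs_Re_le_cmod[of w] by (intro mult_right_mono) auto
        finally have "Re w / \<sigma>\<^sup>2 * ln x \<le> R * \<bar>ln x\<bar> / \<sigma>\<^sup>2"
          using \<sigma> by (simp add: divide_right_mono)
        \<comment> \<open>The sign of \<open>ln x\<close> decides which of the two kernels is the
          larger one. As both are positive, their sum majorizes either, and \<open>exp (- x)\<close>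
          is at most 1.\<close>
        then have "Re w / \<sigma>\<^sup>2 * ln x \<le> R / \<sigma>\<^sup>2 * ln x \<or> Re w / \<sigma>\<^sup>2 * ln x \<le> (- R) / \<sigma>\<^sup>2 * ln x"
          by (auto simp: abs_if split: if_splits)
        then have "exp (- x - 1 / (2 * \<sigma>\<^sup>2) * (ln x)\<^sup>2 + Re w / \<sigma>\<^sup>2 * ln x)
          \<le> exp (- (1 / (2 * \<sigma>\<^sup>2) * (ln x)\<^sup>2) + R / \<sigma>\<^sup>2 * ln x) \<or>
            exp (- x - 1 / (2 * \<sigma>\<^sup>2) * (ln x)\<^sup>2 + Re w / \<sigma>\<^sup>2 * ln x)
          \<le> exp (- (1 / (2 * \<sigma>\<^sup>2) * (ln x)\<^sup>2) + (- R) / \<sigma>\<^sup>2 * ln x)"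
          using True unfolding exp_le_cancel_iff by linarith
        then have "exp (- x - 1 / (2 * \<sigma>\<^sup>2) * (ln x)\<^sup>2 + Re w / \<sigma>\<^sup>2 * ln x)
          \<le> exp (- (1 / (2 * \<sigma>\<^sup>2) * (ln x)\<^sup>2) + R / \<sigma>\<^sup>2 * ln x) +
            exp (- (1 / (2 * \<sigma>\<^sup>2) * (ln x)\<^sup>2) + (- R) / \<sigma>\<^sup>2 * ln x)"
          by (smt (verit) exp_gt_zero)
        then have "1 / x * exp (- x - 1 / (2 * \<sigma>\<^sup>2) * (ln x)\<^sup>2 + Re w / \<sigma>\<^sup>2 * ln x)
          \<le> (lognormal_density R \<sigma> x + lognormal_density (- R) \<sigma> x) / c"
          unfolding add_divide_distrib k distrib_left[symmetric]
          using True by (intro mult_left_mono) auto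
        moreover have "norm (f w x) = 1 / x * exp (- x - 1 / (2 * \<sigma>\<^sup>2) * (ln x)\<^sup>2 + Re w / \<sigma>\<^sup>2 * ln x)"
          using True by (simp add: f_def norm_mult norm_divide flip: of_real_power)
        ultimately show ?thesis by simp
      next
        case False
        then show ?thesis
          using c \<sigma> by (simp add: f_def lognormal_density_nonneg)
      qed
    qed auto
  qed
  \<comment> \<open>The majorant depends on \<open>R\<close>, but differentiability is local: each
    \<open>w\<close> lies in the disc of radius \<open>norm w + 1\<close>.\<close>
  have "(\<lambda>w. \<integral>x. f w x \<partial>lborel) holomorphic_on UNIV"
    unfolding holomorphic_on_def
  proof
    fix w :: complex
    have "(\<lambda>w. \<integral>x. f w x \<partial>lborel) field_differentiable (at w)"
      by (rule holomorphic_on_imp_differentiable_at[OF hol_int[of "norm w + 1"]]) auto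
    then show "(\<lambda>w. \<integral>x. f w x \<partial>lborel) field_differentiable (at w within UNIV)"
      by simp
  qed
  then have "(\<lambda>w. C_coeff w \<sigma> * (\<integral>x. f w x \<partial>lborel)) holomorphic_on UNIV"
    unfolding C_coeff_def using \<sigma> by (intro holomorphic_intros) auto
  then show ?thesis
    unfolding Phi using holomorphic_on_subset by blast
qed

section \<open>Continuation to the slit plane\<close>

lemma Phi_1_Ln_holomorphic:
  assumes "\<sigma> > 0" "integrable lborel (lognormal_density m \<sigma>)"
  shows "(\<lambda>z. Phi 1 (complex_of_real m + Ln z) \<sigma>) holomorphic_on - \<real>\<^sub>\<le>\<^sub>0"
  by (rule holomorphic_on_compose[OF _ Phi_1_holomorphic[OF assms], unfolded o_def])
     (intro holomorphic_intros, auto)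

text \<open>The exponential has modulus at most 1 for \<open>x > 0\<close>, and elsewhere the
  density vanishes. The bound is uniform over the closed half-plane, so it serves both for
  holomorphy inside and for the limit at the boundary.\<close>

lemma norm_lognormal_density_exp_le:
  assumes "\<sigma> > 0" "Re z \<ge> 0"
  shows "norm (lognormal_density m \<sigma> x *\<^sub>R exp (- z * complex_of_real x)) \<le> lognormal_density m \<sigma> x"
proof (cases "x > 0")
  case True
  then show ?thesis
    using assms lognormal_density_nonneg[of \<sigma> m x] by (simp add: mult_left_le)
qed (simp add: lognormal_density_def)

lemma Phi_continuation:
  assumes \<sigma>: "\<sigma> > 0" and int: "integrable lborel (lognormal_density m \<sigma>)"
    and z: "z \<noteq> 0" "Re z \<ge> 0"
  shows "Phi z (complex_of_real m) \<sigma> = Phi 1 (complex_of_real m + Ln z) \<sigma>"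
proof -
  define H where "H = {z. Re z > 0}"
  define D where "D z = Phi z (complex_of_real m) \<sigma> - Phi 1 (complex_of_real m + Ln z) \<sigma>" for z
  have H: "open H" "connected H"
    unfolding H_def by (simp_all add: open_halfspace_Re_gt convex_connected convex_halfspace_Re_gt)
  note hol1 = Phi_1_Ln_holomorphic[OF \<sigma> int]
  have "(\<lambda>z. Phi z (complex_of_real m) \<sigma>) holomorphic_on H"
    unfolding Phi_of_real[OF \<sigma>]
  proof (rule holomorphic_on_integral[OF H(1) _ _ int])
    show "(\<lambda>z. lognormal_density m \<sigma> x *\<^sub>R exp (- z * complex_of_real x)) holomorphic_on H" for x
      unfolding scaleR_conv_of_real by (intro holomorphic_intros)
    show "norm (lognormal_density m \<sigma> x *\<^sub>R exp (- z * complex_of_real x)) \<le> lognormal_density m \<sigma> x"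
      if "z \<in> H" for z x
      using that by (intro norm_lognormal_density_exp_le[OF \<sigma>]) (simp add: H_def)
  qed auto
  moreover have "(\<lambda>z. Phi 1 (complex_of_real m + Ln z) \<sigma>) holomorphic_on H"
    using hol1 by (rule holomorphic_on_subset) (auto simp: H_def complex_nonpos_Reals_iff)
  ultimately have "D holomorphic_on H"
    unfolding D_def by (rule holomorphic_on_diff)
  \<comment> \<open>The identity theorem needs zeros of \<open>D\<close> accumulating inside
    \<open>H\<close>; the positive reals near 1 provide them. \<open>Suc n\<close> keeps the
    denominators nonzero, so no term of the sequence equals 1.\<close>
  moreover have "1 islimpt complex_of_real ` {0<..}"
    unfolding islimpt_sequential
  proof (intro exI[of _ "\<lambda>n. complex_of_real (1 + 1 / real (Suc n))"] conjI allI)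
    show "complex_of_real (1 + 1 / real (Suc n)) \<in> complex_of_real ` {0<..} - {1}" for n
    proof (intro DiffI imageI)
      show "complex_of_real (1 + 1 / real (Suc n)) \<notin> {1}"
        unfolding singleton_iff of_real_eq_1_iff by simp
    qed (simp add: add_pos_pos)
    have "(\<lambda>n. complex_of_real (1 + 1 / real (Suc n))) \<longlonglongrightarrow> complex_of_real (1 + 0)"
      by (intro tendsto_intros LIMSEQ_Suc[OF lim_1_over_n])
    then show "(\<lambda>n. complex_of_real (1 + 1 / real (Suc n))) \<longlonglongrightarrow> 1" by simp
  qed
  moreover have "D x = 0" if "x \<in> complex_of_real ` {0<..}" for x
  proof -
    obtain t where t: "t > 0" "x = complex_of_real t" using \<open>x \<in> _\<close> by auto
    then show ?thesis
      using Phi_of_real_scale[OF \<sigma> t(1), of 1 m] by (simp add: D_def Ln_of_real)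
  qed
  ultimately have eq: "D u = 0" if "u \<in> H" for u
    using analytic_continuation[of D H "complex_of_real ` {0<..}" 1 u] H that
    by (force simp: H_def)
  \<comment> \<open>Shifting \<open>z\<close> to the right puts it strictly inside \<open>H\<close>
    even when \<open>Re z = 0\<close>, so boundary and interior points are treated alike.\<close>
  define u where "u n = z + complex_of_real (1 / real (Suc n))" for n
  have uH: "u n \<in> H" for n
    using z(2) unfolding u_def H_def mem_Collect_eq plus_complex.sel Re_complex_of_real
    by (intro add_nonneg_pos) simp_all
  have ulim: "u \<longlonglongrightarrow> z"
  proof -
    have "u \<longlonglongrightarrow> z + complex_of_real 0"
      unfolding u_def by (intro tendsto_intros LIMSEQ_Suc[OF lim_1_over_n])
    then show ?thesis by simp
  qed
  have "(\<lambda>n. Phi (u n) (complex_of_real m) \<sigma>) \<longlonglongrightarrow> Phi z (complex_of_real m) \<sigma>"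
    unfolding Phi_of_real[OF \<sigma>]
  proof (rule integral_dominated_convergence[OF _ _ int])
    show "AE x in lborel. (\<lambda>n. lognormal_density m \<sigma> x *\<^sub>R exp (- u n * complex_of_real x))
        \<longlonglongrightarrow> lognormal_density m \<sigma> x *\<^sub>R exp (- z * complex_of_real x)"
      by (intro AE_I2 tendsto_intros ulim)
    show "AE x in lborel. norm (lognormal_density m \<sigma> x *\<^sub>R exp (- u n * complex_of_real x))
        \<le> lognormal_density m \<sigma> x" for n
      using uH[of n] by (intro AE_I2 norm_lognormal_density_exp_le[OF \<sigma>]) (simp add: H_def)
  qed auto
  moreover have "(\<lambda>n. Phi 1 (complex_of_real m + Ln (u n)) \<sigma>) \<longlonglongrightarrow> Phi 1 (complex_of_real m + Ln z) \<sigma>"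
  proof (rule isCont_tendsto_compose[OF _ ulim, where g = "\<lambda>z. Phi 1 (complex_of_real m + Ln z) \<sigma>"])
    \<comment> \<open>The closed right half-plane meets the branch cut only at 0, which
      \<open>z \<noteq> 0\<close> excludes.\<close>
    have "z \<in> - \<real>\<^sub>\<le>\<^sub>0" using z by (auto simp: complex_nonpos_Reals_iff complex_eq_iff)
    then show "isCont (\<lambda>z. Phi 1 (complex_of_real m + Ln z) \<sigma>) z"
      using holomorphic_on_imp_continuous_on[OF hol1]
      by (simp add: continuous_on_eq_continuous_at open_Compl)
  qed
  moreover have "Phi (u n) (complex_of_real m) \<sigma> = Phi 1 (complex_of_real m + Ln (u n)) \<sigma>" for n
    using eq[OF uH[of n]] by (simp add: D_def)
  ultimately show ?thesis
    by (simp add: LIMSEQ_unique)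
qed

section \<open>Passage from the random variable to its density\<close>

lemma integrable_lognormal_density:
  assumes "prob_space M" "\<sigma> > 0" "lognormal_distributed M X m \<sigma>"
  shows "integrable lborel (lognormal_density m \<sigma>)"
proof -
  interpret prob_space M by fact
  show ?thesis
    \<comment> \<open>The constant 1 is integrable over a probability space; transported along
      \<open>X\<close>, this says that the density itself is integrable.\<close>
    using distributed_integrable[OF assms(3)[unfolded lognormal_distributed_def], of "\<lambda>_. 1"]
      lognormal_density_nonneg[OF assms(2)] by simp
qed

text \<open>The expectation is pushed forward along \<open>X\<close> and the law is replaced by its
  density, which gives the integral in \<open>Phi_of_real\<close>.\<close>

lemma laplace_transform_lognormal:
  assumes "\<sigma> > 0" "lognormal_distributed M X m \<sigma>"
  shows "laplace_transform M X z = Phi z (complex_of_real m) \<sigma>"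
proof -
  have D: "distributed M lborel X (\<lambda>x. ennreal (lognormal_density m \<sigma> x))"
    using assms(2) by (simp add: lognormal_distributed_def)
  have "laplace_transform M X z = (\<integral>x. exp (- z * complex_of_real x) \<partial>distr M lborel X)"
    unfolding laplace_transform_def
    by (rule integral_distr[symmetric]) (use distributed_measurable[OF D] in auto)
  also have "\<dots> = Phi z (complex_of_real m) \<sigma>"
    unfolding distributed_distr_eq_density[OF D] Phi_of_real[OF assms(1)]
    by (rule integral_density) (use assms lognormal_density_nonneg in auto)
  finally show ?thesis .
qed

theorem theorem1:
  fixes M :: "'a measure" and X :: "'a \<Rightarrow> real" and \<mu> \<sigma> :: real
  assumes "prob_space M"
    and "\<sigma> > 0"
    and "lognormal_distributed M X \<mu> \<sigma>"
  shows "(\<lambda>z. Phi 1 (complex_of_real \<mu> + Ln z) \<sigma>) analytic_on (- \<real>\<^sub>\<le>\<^sub>0)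
    \<and> (\<forall>z. z \<noteq> 0 \<and> Re z \<ge> 0 \<longrightarrow>
          laplace_transform M X z = Phi 1 (complex_of_real \<mu> + Ln z) \<sigma>)"
proof -
  note int = integrable_lognormal_density[OF assms]
  have "(\<lambda>z. Phi 1 (complex_of_real \<mu> + Ln z) \<sigma>) holomorphic_on (- \<real>\<^sub>\<le>\<^sub>0)"
    by (rule Phi_1_Ln_holomorphic[OF assms(2) int])
  then have "(\<lambda>z. Phi 1 (complex_of_real \<mu> + Ln z) \<sigma>) analytic_on (- \<real>\<^sub>\<le>\<^sub>0)"
    by (simp add: analytic_on_open open_Compl)
  then show ?thesis
    using laplace_transform_lognormal[OF assms(2,3)] Phi_continuation[OF assms(2) int] by simp
qed

end
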